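(* Let $p$ be a prime, let $I$ be a finite index set, and let $g_i\in\mathbb{Z}[X]$, $i\in I$, be irreducible in $\mathbb{Z}[X]$. Let $g(X)=\prod_{i\in I}g_i(X)$, assume that $p$ does not divide the content of $g$, and let $$f(X)=\frac{g(X)}{p}=\frac{\prod_{i\in I}g_i(X)}{p}.$$ Suppose that $f\in\mathrm{Int}(\mathbb{Z})$ and that $f$ is image primitive. Then $f(X)$ is irreducible in $\mathrm{Int}(\mathbb{Z})$ if and only if there is no proper subset $J\subsetneq I$ such that $\bigcup_{i\in J}C_{p,g_i}=\{0,\ldots,p-1\}$ (that is, $I$ is a minimal $p$-covering for $\{g_i\}_{i\in I}$).
   Context: $\mathrm{Int}(\mathbb{Z})=\{f\in\mathbb{Q}[X] : f(\mathbb{Z})\subset\mathbb{Z}\}$ is the ring of integer-valued polynomials; its units are $\pm1$. For $f\in\mathrm{Int}(\mathbb{Z})$, the fixed divisor $d(f)$ is the g.c.d. of $\{f(n): n\in\mathbb{Z}\}$, and $f$ is image primitive if $d(f)=1$. The content of a polynomial in $\mathbb{Z}[X]$ is the g.c.d. of its coefficients. For $g\in\mathbb{Z}[X]$ and a prime $p$, $C_{p,g}=\{j\in\{0,\ldots,p-1\} : p\mid g(j)\}$. Given a family $\{g_i\}_{i\in I}$ of polynomials in $\mathbb{Z}[X]$ (repetitions allowed), a $p$-covering for it is a subset $J\subseteq I$ such that $\bigcup_{i\in J}C_{p,g_i}=\{0,\ldots,p-1\}$ (with the convention that $C_{p,g_i}\neq\emptyset$ for each $i\in J$); it is minimal if no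 proper subset of $J$ is a $p$-covering. *)

theory Defs
  imports "HOL-Computational_Algebra.Computational_Algebra"
begin

definition Int_Z :: "rat poly set" where
  "Int_Z = {f. \<forall>n::int. poly f (of_int n) \<in> \<int>}"

text \<open>
  The ring \<open>Int(Z)\<close> is made a type of its own, so that divisibility, units and \<^const>\<open>irreducible\<close>
  refer to this ring and not to the polynomial ring over the rationals. The abstraction function
  \<open>ivp_of\<close> is meaningful only on members of \<^const>\<open>Int_Z\<close>.
\<close>

typedef int_valued_poly = Int_Z
  morphisms rat_poly_of ivp_of
  by (rule exI[of _ 0]) (simp add: Int_Z_def)

setup_lifting type_definition_int_valued_poly

instantiation int_valued_poly :: idom
begin

lift_definition zero_int_valued_poly :: int_valued_poly is 0
  by (simp add: Int_Z_def)

lift_definition one_int_valued_poly :: int_valued_poly is 1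
  by (simp add: Int_Z_def)

lift_definition plus_int_valued_poly :: "int_valued_poly \<Rightarrow> int_valued_poly \<Rightarrow> int_valued_poly"
  is "(+)" by (simp add: Int_Z_def)

lift_definition uminus_int_valued_poly :: "int_valued_poly \<Rightarrow> int_valued_poly"
  is uminus by (simp add: Int_Z_def)

lift_definition minus_int_valued_poly :: "int_valued_poly \<Rightarrow> int_valued_poly \<Rightarrow> int_valued_poly"
  is "(-)" by (simp add: Int_Z_def)

lift_definition times_int_valued_poly :: "int_valued_poly \<Rightarrow> int_valued_poly \<Rightarrow> int_valued_poly"
  is "(*)" by (simp add: Int_Z_def)

instance
  by standard (transfer; simp add: algebra_simps)+

end

text \<open>The values are collected as integers because over the rationals, a field, a g.c.d. carries
  no information; for \<open>f \<in> Int_Z\<close> no value is lost.\<close>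

definition fixed_divisor :: "rat poly \<Rightarrow> int" where
  "fixed_divisor f = Gcd {k. \<exists>n::int. poly f (of_int n) = of_int k}"

definition image_primitive :: "rat poly \<Rightarrow> bool" where
  "image_primitive f \<longleftrightarrow> fixed_divisor f = 1"

definition root_residues :: "int \<Rightarrow> int poly \<Rightarrow> int set" where
  "root_residues p g = {j \<in> {0..p - 1}. p dvd poly g j}"

definition p_covering :: "int \<Rightarrow> 'i set \<Rightarrow> ('i \<Rightarrow> int poly) \<Rightarrow> 'i set \<Rightarrow> bool" where
  "p_covering p I g J \<longleftrightarrow> J \<subseteq> I \<and> (\<Union>i\<in>J. root_residues p (g i)) = {0..p - 1}
     \<and> (\<forall>i\<in>J. root_residues p (g i) \<noteq> {})"

definition minimal_p_covering :: "int \<Rightarrow> 'i set \<Rightarrow> ('i \<Rightarrow> int poly) \<Rightarrow> 'i set \<Rightarrow> bool" where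
  "minimal_p_covering p I g J \<longleftrightarrow> p_covering p I g J \<and> (\<forall>K. K \<subset> J \<longrightarrow> \<not> p_covering p I g K)"

end

theory Submission
  imports Defs
begin

text \<open>
  By Gauss's lemma, every factorization of \<open>f\<close> in \<open>Int(Z)\<close> has the form
  \<open>f = (c * (\<Prod>i\<in>J. g i)) * (d * (\<Prod>i\<in>I - J. g i))\<close> with rational \<open>c\<close>, \<open>d\<close> and \<open>c * d = 1 / p\<close>.
  So \<open>p\<close> divides the denominator of \<open>c\<close> or of \<open>d\<close>, and integrality of the values makes \<open>J\<close>
  or \<open>I - J\<close> cover all residues. If no proper subset does, the other factor is a constant,
  and as such divides the fixed divisor \<open>1\<close>. Conversely, a proper covering subset \<open>J\<close> splits off
  the integer-valued factor \<open>(\<Prod>i\<in>J. g i) / p\<close>; both factors are nonconstant because a constant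
  \<open>g i\<close> would be a prime dividing the content or the fixed divisor.
\<close>

section \<open>Embedding of integer polynomials into the rational polynomials\<close>

abbreviation rat_poly :: "int poly \<Rightarrow> rat poly" where
  "rat_poly \<equiv> map_poly of_int"

lemma poly_rat_poly: "poly (rat_poly q) (of_int n) = of_int (poly q n)"
  by (induction q) (simp_all add: map_poly_pCons)

lemma rat_poly_mult: "rat_poly (q * r) = rat_poly q * rat_poly r"
  by (simp add: poly_eq_iff coeff_map_poly coeff_mult)

lemma rat_poly_inj: "rat_poly q = rat_poly r \<longleftrightarrow> q = r"
  by (simp add: poly_eq_iff coeff_map_poly)

lemma degree_rat_poly: "degree (rat_poly q) = degree q"
  by (rule degree_map_poly) simp

section \<open>Factorizations over the rationals and their denominators\<close>

lemma clear_denominators: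
  fixes a :: "rat poly"
  obtains m :: int and A :: "int poly" where "m > 0" "smult (of_int m) a = rat_poly A"
proof -
  have "\<exists>m A. (m::int) > 0 \<and> smult (of_int m) a = rat_poly A"
  proof (induction a)
    case 0
    show ?case by (rule exI[of _ 1], rule exI[of _ 0]) simp
  next
    case (pCons x a)
    then obtain m A where m: "m > 0" "smult (of_int m) a = rat_poly A" by blast
    obtain u v where uv: "quotient_of x = (u, v)" by (cases "quotient_of x")
    have v: "v > 0" "x = of_int u / of_int v"
      using quotient_of_denom_pos[OF uv] quotient_of_div[OF uv] by auto
    have "smult (of_int v) (smult (of_int m) a) = rat_poly (smult v A)"
      by (simp add: m(2) poly_eq_iff coeff_map_poly)
    then have "smult (of_int (m * v)) (pCons x a) = rat_poly (pCons (m * u) (smult v A))"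
      using v by (simp add: map_poly_pCons mult.commute)
    moreover have "m * v > 0" using m v by simp
    ultimately show ?case by blast
  qed
  then show ?thesis using that by blast
qed

text \<open>Each prime \<open>g x\<close> divides \<open>A\<close> or \<open>B\<close> and can be
  cancelled there; induction over \<open>I\<close> records in \<open>J\<close> the primes taken from
  \<open>A\<close>. What remains after all cancellations is a factorization of
  \<open>e\<close>.\<close>

lemma prod_prime_elems_split:
  fixes g :: "'i \<Rightarrow> 'a :: idom"
  assumes "finite I" "\<And>i. i \<in> I \<Longrightarrow> prime_elem (g i)" "e * (\<Prod>i\<in>I. g i) = A * B"
  obtains J A' B' where "J \<subseteq> I" "A = A' * (\<Prod>i\<in>J. g i)" "B = B' * (\<Prod>i\<in>I - J. g i)" "e = A' * B'"
proof -
  have "\<exists>J A' B'. J \<subseteq> I \<and> A = A' * (\<Prod>i\<in>J. g i) \<and> B = B' * (\<Prod>i\<in>I - J. g i) \<and> e = A' * B'"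
    using assms
  proof (induction I arbitrary: A B rule: finite_induct)
    case empty
    then show ?case by (intro exI[of _ "{}"]) auto
  next
    case (insert x I)
    have px: "prime_elem (g x)" and px0: "g x \<noteq> 0"
      using insert.prems(1)[of x] by auto
    have eq: "g x * (e * prod g I) = A * B"
      using insert by (simp add: ac_simps)
    \<comment> \<open>Needed for all \<open>A\<close> and \<open>B\<close>, since cancelling
      \<open>g x\<close> changes one of the two factors.\<close>
    have IH: "\<exists>J A' B'. J \<subseteq> I \<and> A = A' * prod g J \<and> B = B' * prod g (I - J) \<and> e = A' * B'"
      if "e * prod g I = A * B" for A B
      using insert.IH[OF _ that] insert.prems(1) by blast
    from eq have "g x dvd A * B" by (metis dvd_triv_left)
    then consider "g x dvd A" | "g x dvd B" using px by (auto simp: prime_elem_dvd_mult_iff)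
    then show ?case
    proof cases
      case 1
      then obtain A1 where A1: "A = g x * A1" by (elim dvdE)
      with eq px0 have "e * prod g I = A1 * B" by (simp add: mult.assoc)
      from IH[OF this] obtain J A' B' where
        J: "J \<subseteq> I" "A1 = A' * prod g J" "B = B' * prod g (I - J)" "e = A' * B'" by (elim exE conjE)
      have "finite J" "x \<notin> J" "insert x I - insert x J = I - J"
        using J(1) insert.hyps by (auto intro: finite_subset)
      with J A1 have "insert x J \<subseteq> insert x I \<and> A = A' * prod g (insert x J)
          \<and> B = B' * prod g (insert x I - insert x J) \<and> e = A' * B'"
        by (auto simp: ac_simps)
      then show ?thesis by blast
    next
      case 2
      then obtain B1 where B1: "B = g x * B1" by (elim dvdE)
      with eq px0 have "e * prod g I = A * B1" by (simp add: mult.left_commute)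
      from IH[OF this] obtain J A' B' where
        J: "J \<subseteq> I" "A = A' * prod g J" "B1 = B' * prod g (I - J)" "e = A' * B'" by blast
      have "insert x I - J = insert x (I - J)" "finite (I - J)" "x \<notin> I - J"
        using J(1) insert.hyps by auto
      with J B1 show ?thesis
        by (intro exI[of _ J] exI[of _ A'] exI[of _ B']) (auto simp: ac_simps)
    qed
  qed
  then show ?thesis using that by blast
qed

text \<open>This is where Gauss's lemma enters: irreducible elements of the factorial ring of
  integer polynomials are prime, so once denominators are cleared the \<open>g i\<close> are
  distributed over the two factors. The cofactors multiply to a nonzero constant and are therefore
  constants.\<close>

lemma rat_poly_factor_split:
  fixes g :: "'i \<Rightarrow> int poly"
  assumes "finite I" "\<And>i. i \<in> I \<Longrightarrow> irreducible (g i)" "(p::int) \<noteq> 0"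
    and eq: "smult (1 / of_int p) (rat_poly (\<Prod>i\<in>I. g i)) = a * b"
  obtains J c d where "J \<subseteq> I" "a = smult c (rat_poly (\<Prod>i\<in>J. g i))"
    "b = smult d (rat_poly (\<Prod>i\<in>I - J. g i))" "c * d = 1 / of_int p"
proof -
  obtain m A where m: "m > 0" "smult (of_int m) a = rat_poly A" by (rule clear_denominators)
  obtain k B where k: "k > 0" "smult (of_int k) b = rat_poly B" by (rule clear_denominators)
  have smult_rat_poly: "rat_poly (smult z q) = smult (of_int z) (rat_poly q)" for z q
    by (simp add: poly_eq_iff coeff_map_poly)
  \<comment> \<open>The scalar \<open>p * m * k\<close> cancels \<open>1 / p\<close> on the left and
    clears both denominators on the right; its factor \<open>p\<close> is given to
    \<open>A\<close>.\<close>
  have "rat_poly ([:m * k:] * prod g I) = smult (of_int (p * m * k)) (a * b)"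
    using assms(3) by (simp add: smult_rat_poly mult.commute flip: eq)
  also have "\<dots> = smult (of_int p) (smult (of_int m) a * smult (of_int k) b)"
    by (simp add: mult.commute mult.left_commute)
  also have "\<dots> = rat_poly (smult p A * B)"
    unfolding m k by (simp add: smult_rat_poly rat_poly_mult)
  finally have "[:m * k:] * prod g I = smult p A * B" by (simp only: rat_poly_inj)
  then obtain J A' B' where J: "J \<subseteq> I" "smult p A = A' * prod g J" "B = B' * prod g (I - J)"
    and AB: "[:m * k:] = A' * B'"
    using prod_prime_elems_split[OF assms(1), of g] assms(2) irreducible_imp_prime_elem by metis
  have nz: "A' \<noteq> 0" "B' \<noteq> 0" using AB m k by auto
  then have "degree A' + degree B' = 0" using AB by (metis degree_mult_eq degree_pCons_0)
  then obtain u w where uw: "A' = [:u:]" "B' = [:w:]"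
    by (metis add_eq_0_iff_both_eq_0 degree_eq_zeroE)
  have mk: "m * k = u * w" using AB uw by simp
  have "smult (of_int (p * m)) a = rat_poly (smult p A)"
    by (simp add: smult_rat_poly m(2)[symmetric])
  also have "\<dots> = smult (of_int u) (rat_poly (prod g J))" by (simp add: J uw smult_rat_poly)
  finally have "smult (1 / of_int (p * m)) (smult (of_int (p * m)) a)
      = smult (1 / of_int (p * m)) (smult (of_int u) (rat_poly (prod g J)))" by simp
  then have a: "a = smult (of_int u / of_int (p * m)) (rat_poly (prod g J))"
    using m(1) assms(3) by simp
  have "smult (of_int k) b = smult (of_int w) (rat_poly (prod g (I - J)))"
    by (simp add: J uw smult_rat_poly k(2))
  then have "smult (1 / of_int k) (smult (of_int k) b)
      = smult (1 / of_int k) (smult (of_int w) (rat_poly (prod g (I - J))))" by simp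
  then have b: "b = smult (of_int w / of_int k) (rat_poly (prod g (I - J)))"
    using k(1) by simp
  have "(of_int u / of_int (p * m)) * (of_int w / of_int k) = (of_int (m * k) :: rat) / (of_int (p * m * k))"
    unfolding mk by simp
  also have "\<dots> = 1 / of_int p" using m(1) k(1) by simp
  finally show ?thesis using that J(1) a b by blast
qed

text \<open>Writing \<open>c = u / v\<close> and \<open>d = w / z\<close> turns the equation into
  \<open>p * (u * w) = v * z\<close>, and \<open>p\<close> is prime.\<close>

lemma rat_mult_eq_inverse_prime:
  fixes c d :: rat
  assumes "prime p" "c * d = 1 / of_int p"
  shows "p dvd snd (quotient_of c) \<or> p dvd snd (quotient_of d)"
proof -
  obtain u v where uv: "quotient_of c = (u, v)" by (cases "quotient_of c")
  obtain w z where wz: "quotient_of d = (w, z)" by (cases "quotient_of d")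
  have pos: "v > 0" "z > 0" using quotient_of_denom_pos uv wz by auto
  have p: "p > 0" using assms(1) by (simp add: prime_gt_0_int)
  have "of_int u / of_int v * (of_int w / of_int z) = (1 :: rat) / of_int p"
    using assms(2) quotient_of_div[OF uv] quotient_of_div[OF wz] by simp
  then have "of_int (p * (u * w)) = (of_int (v * z) :: rat)"
    using pos p by (simp add: field_simps)
  then have "p * (u * w) = v * z" by (simp only: of_int_eq_iff)
  then have "p dvd v * z" by (metis dvd_triv_left)
  then show ?thesis using uv wz assms(1) by (simp add: prime_dvd_mult_iff)
qed

text \<open>For \<open>c = u / v\<close> in lowest terms, \<open>v\<close> divides
  \<open>u * n\<close> and is coprime to \<open>u\<close>.\<close>

lemma denominator_dvd:
  assumes "c * of_int n \<in> (\<int> :: rat set)"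
  shows "snd (quotient_of c) dvd n"
proof -
  obtain u v where uv: "quotient_of c = (u, v)" by (cases "quotient_of c")
  have v: "v > 0" using quotient_of_denom_pos uv by auto
  obtain k where "c * of_int n = of_int k" using assms by (elim Ints_cases)
  then have "of_int (u * n) = (of_int (v * k) :: rat)"
    using v quotient_of_div[OF uv] by (simp add: field_simps)
  then have "u * n = v * k" by (simp only: of_int_eq_iff)
  then have "v dvd n * u" by (metis dvd_triv_left mult.commute)
  moreover have "coprime v u" using quotient_of_coprime[OF uv] by (simp add: coprime_commute)
  ultimately show ?thesis using uv by (simp add: coprime_dvd_mult_left_iff)
qed

section \<open>Residues modulo \<open>p\<close> and integrality of values\<close>

lemma poly_mod_dvd_iff:
  fixes p :: int
  shows "p dvd poly q (n mod p) \<longleftrightarrow> p dvd poly q n"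
proof -
  have "poly q (n mod p) mod p = poly q n mod p"
  proof (induction q)
    case (pCons a q)
    have "poly (pCons a q) (n mod p) mod p = (a + (n mod p) * (poly q (n mod p) mod p)) mod p"
      by (metis mod_add_right_eq mod_mult_right_eq poly_pCons)
    also have "\<dots> = poly (pCons a q) n mod p"
      unfolding pCons.IH by (metis mod_add_right_eq mod_mult_eq poly_pCons)
    finally show ?case .
  qed simp
  then show ?thesis by (simp add: dvd_eq_mod_eq_0)
qed

text \<open>A prime divides a value of the product exactly if it divides the value of some factor,
  and whether it does so depends only on \<open>n mod p\<close>.\<close>

lemma root_residues_cover_iff:
  assumes "prime (p::int)" "finite J"
  shows "(\<Union>i\<in>J. root_residues p (g i)) = {0..p - 1} \<longleftrightarrow> (\<forall>n. p dvd poly (\<Prod>i\<in>J. g i) n)"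
    (is "?L \<longleftrightarrow> ?R")
proof
  have p: "p > 0" using assms(1) by (simp add: prime_gt_0_int)
  have dvd_iff: "p dvd poly (prod g J) n \<longleftrightarrow> (\<exists>i\<in>J. p dvd poly (g i) n)" for n
    using assms by (simp add: poly_prod prime_dvd_prod_iff)
  show ?R if ?L
  proof
    fix n
    have "n mod p \<in> {0..p - 1}" using p by simp
    with that obtain i where "i \<in> J" "p dvd poly (g i) (n mod p)"
      unfolding root_residues_def by blast
    then show "p dvd poly (prod g J) n" by (auto simp: dvd_iff poly_mod_dvd_iff)
  qed
  show ?L if ?R
    using that unfolding dvd_iff root_residues_def by auto
qed

lemma smult_rat_poly_Int_Z_iff:
  assumes "p \<noteq> 0"
  shows "smult (1 / of_int p) (rat_poly q) \<in> Int_Z \<longleftrightarrow> (\<forall>n. p dvd poly q n)"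
proof -
  have "(of_int k / of_int p :: rat) \<in> \<int> \<longleftrightarrow> p dvd k" for k
  proof
    assume "(of_int k / of_int p :: rat) \<in> \<int>"
    then obtain l where "(of_int k / of_int p :: rat) = of_int l" by (elim Ints_cases)
    then have "(of_int k :: rat) = of_int (p * l)" using assms by (simp add: field_simps)
    then show "p dvd k" by (metis dvd_triv_left of_int_eq_iff)
  qed (use assms in auto)
  then show ?thesis by (simp add: Int_Z_def poly_rat_poly)
qed

section \<open>Units and constant factors in the ring of integer-valued polynomials\<close>

lemma rat_poly_in_Int_Z: "rat_poly q \<in> Int_Z"
  by (simp add: Int_Z_def poly_rat_poly)

lemma ivp_of_eq_iff: "a \<in> Int_Z \<Longrightarrow> ivp_of a = x \<longleftrightarrow> a = rat_poly_of x"
  using ivp_of_inverse rat_poly_of_inverse by metis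

lemma ivp_dvd_1_imp_degree:
  assumes "x dvd 1"
  shows "degree (rat_poly_of x) = 0"
proof -
  obtain y where "1 = x * y" using assms by (elim dvdE)
  then have "rat_poly_of x * rat_poly_of y = 1"
    by (metis one_int_valued_poly.rep_eq times_int_valued_poly.rep_eq)
  then have "rat_poly_of x dvd 1" "rat_poly_of x \<noteq> 0" by (metis dvd_triv_left, auto)
  then show ?thesis by (simp add: is_unit_iff_degree)
qed

text \<open>The constant is an integer dividing every value of the product, hence dividing the fixed
  divisor 1.\<close>

lemma ivp_const_factor_unit:
  assumes "rat_poly_of x = [:c:]" "image_primitive (rat_poly_of (x * y))"
  shows "x dvd 1"
proof -
  have "c \<in> \<int>" using rat_poly_of[of x] assms(1) by (simp add: Int_Z_def)
  then obtain k where k: "c = of_int k" by (elim Ints_cases)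
  have "k dvd fixed_divisor (rat_poly_of (x * y))"
    unfolding fixed_divisor_def
  proof (rule Gcd_greatest)
    fix l assume "l \<in> {l. \<exists>n. poly (rat_poly_of (x * y)) (of_int n) = of_int l}"
    then obtain n where n: "poly (rat_poly_of (x * y)) (of_int n) = of_int l" by blast
    have "poly (rat_poly_of y) (of_int n) \<in> \<int>" using rat_poly_of[of y] by (simp add: Int_Z_def)
    then obtain r where "poly (rat_poly_of y) (of_int n) = of_int r" by (elim Ints_cases)
    then have "of_int l = (of_int (k * r) :: rat)"
      using n assms(1) k by (simp add: times_int_valued_poly.rep_eq)
    then show "k dvd l" by (metis dvd_triv_left of_int_eq_iff)
  qed
  \<comment> \<open>Squaring avoids separating the signs of \<open>k\<close>: \<open>x\<close> is
    its own inverse.\<close>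
  then have "k * k = 1" using assms(2) by (auto simp: image_primitive_def abs_if split: if_splits)
  then have "(of_int k * of_int k :: rat) = 1" by (metis of_int_1 of_int_mult)
  then have "rat_poly_of (x * x) = rat_poly_of 1"
    using assms(1) k
    by (simp add: times_int_valued_poly.rep_eq one_int_valued_poly.rep_eq one_pCons)
  then have "1 = x * x" by (simp add: rat_poly_of_inject)
  then show ?thesis by (rule dvdI)
qed

text \<open>A constant \<open>q\<close> would be a prime integer \<open>l\<close>. If
  \<open>l\<close> is associated to \<open>p\<close>, then \<open>p\<close> divides the content;
  otherwise \<open>l\<close> survives the division by \<open>p\<close> and divides the fixed
  divisor.\<close>

lemma degree_pos_if_image_primitive:
  fixes p :: int
  assumes "prime p" "irreducible q" "\<not> p dvd content (q * r)"
    and "f = smult (1 / of_int p) (rat_poly (q * r))" "f \<in> Int_Z" "image_primitive f"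
  shows "degree q > 0"
proof (rule ccontr)
  have p: "p > 0" using assms(1) by (simp add: prime_gt_0_int)
  assume "\<not> degree q > 0"
  then obtain l where l: "q = [:l:]" using degree_eq_zeroE by auto
  have "\<not> l dvd 1" using assms(2) l by (auto simp: irreducible_def is_unit_const_poly_iff)
  have "prime_elem l" using assms(2) unfolding l irreducible_const_poly_iff
    by (rule irreducible_imp_prime_elem)
  have np: "\<not> p dvd l" 
    using assms(3) l by auto
  have "l dvd fixed_divisor f"
    unfolding fixed_divisor_def
  proof (rule Gcd_greatest)
    fix k assume "k \<in> {k. \<exists>n. poly f (of_int n) = of_int k}"
    then obtain n where "poly f (of_int n) = of_int k" by blast
    then have "of_int (l * poly r n) = (of_int (p * k) :: rat)"
      using p by (simp add: assms(4) l poly_rat_poly rat_poly_mult map_poly_pCons field_simps)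
    then have "l * poly r n = p * k" by (simp only: of_int_eq_iff)
    then have "l dvd p * k" by (metis dvd_triv_left)
    \<comment> \<open>By irreducibility of \<open>p\<close>, a divisor \<open>l\<close> of
      \<open>p\<close> is a unit or a multiple of \<open>p\<close>; both are excluded.\<close>
    moreover have "\<not> l dvd p"
      using np \<open>\<not> l dvd 1\<close> assms(1) by (metis prime_elem_imp_irreducible irreducibleD' prime_def)
    ultimately show "l dvd k" using \<open>prime_elem l\<close> by (simp add: prime_elem_dvd_mult_iff)
  qed
  with assms(6) \<open>\<not> l dvd 1\<close> show False by (simp add: image_primitive_def)
qed

section \<open>Irreducibility compared with minimality of the covering\<close>

theorem lemma2p3:
  fixes p :: int and I :: "'i set" and g :: "'i \<Rightarrow> int poly" and f :: "rat poly"
  assumes "prime p"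
    and "finite I"
    and "\<And>i. i \<in> I \<Longrightarrow> irreducible (g i)"
    and "\<not> p dvd content (\<Prod>i\<in>I. g i)"
    and "f = smult (1 / of_int p) (map_poly of_int (\<Prod>i\<in>I. g i))"
    and "f \<in> Int_Z"
    and "image_primitive f"
  shows "(irreducible (ivp_of f) \<longleftrightarrow>
            \<not> (\<exists>J. J \<subset> I \<and> (\<Union>i\<in>J. root_residues p (g i)) = {0..p - 1}))
       \<and> (\<not> (\<exists>J. J \<subset> I \<and> (\<Union>i\<in>J. root_residues p (g i)) = {0..p - 1}) \<longleftrightarrow>
            minimal_p_covering p I g I)"
proof -
  have p: "p > 1" using assms(1) by (simp add: prime_gt_1_int)
  have cover_iff: "(\<Union>i\<in>J. root_residues p (g i)) = {0..p - 1} \<longleftrightarrow> (\<forall>n. p dvd poly (prod g J) n)"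
    if "J \<subseteq> I" for J
    by (rule root_residues_cover_iff[OF assms(1) finite_subset[OF that assms(2)]])
  \<comment> \<open>Integrality of the values of \<open>f\<close> says that \<open>p\<close> divides
    every value of \<open>prod g I\<close>.\<close>
  have cover_I: "(\<Union>i\<in>I. root_residues p (g i)) = {0..p - 1}"
    using assms(5,6) p by (simp add: cover_iff smult_rat_poly_Int_Z_iff)
  have not_cover_empty: "(\<Union>i\<in>{}. root_residues p (g i)) \<noteq> {0..p - 1}" using p by simp
  have degree_pos: "degree (g i) > 0" if "i \<in> I" for i
  proof -
    have "prod g I = g i * prod g (I - {i})" using assms(2) that by (rule prod.remove)
    then show ?thesis
      using degree_pos_if_image_primitive[OF assms(1) assms(3)[OF that], of "prod g (I - {i})" f]
        assms(4-7) by simp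
  qed
  have degree_prod_pos: "degree (prod g J) > 0" if "J \<subseteq> I" "J \<noteq> {}" for J
  proof -
    have "g i \<noteq> 0" if "i \<in> J" for i using \<open>J \<subseteq> I\<close> that assms(3) by fastforce
    then have "degree (prod g J) = (\<Sum>i\<in>J. degree (g i))" by (simp add: degree_prod_eq_sum_degree)
    moreover have "finite J" using that(1) assms(2) finite_subset by blast
    ultimately show ?thesis
      using that degree_pos by (metis subsetD sum_pos)
  qed
  have "\<not> irreducible (ivp_of f)"
    if J: "J \<subset> I" and cover: "(\<Union>i\<in>J. root_residues p (g i)) = {0..p - 1}" for J
  proof
    assume irr: "irreducible (ivp_of f)"
    \<comment> \<open>The denominator \<open>p\<close> goes entirely to the covering part, whose
      values are all divisible by \<open>p\<close>.\<close>
    let ?a = "smult (1 / of_int p) (rat_poly (prod g J))" and ?b = "rat_poly (prod g (I - J))"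
    have a: "?a \<in> Int_Z"
      using cover cover_iff J p by (subst smult_rat_poly_Int_Z_iff) auto
    have "f = ?a * ?b"
      using J assms(2,5) by (simp add: prod.subset_diff[of J I] rat_poly_mult mult.commute)
    then have "ivp_of f = ivp_of ?a * ivp_of ?b"
      unfolding ivp_of_eq_iff[OF assms(6)]
      by (simp add: times_int_valued_poly.rep_eq ivp_of_inverse a rat_poly_in_Int_Z)
    then have "ivp_of ?a dvd 1 \<or> ivp_of ?b dvd 1" using irr by (auto dest: irreducibleD)
    then have "degree ?a = 0 \<or> degree ?b = 0"
      using ivp_dvd_1_imp_degree by (metis a rat_poly_in_Int_Z ivp_of_inverse)
    then have "degree (prod g J) = 0 \<or> degree (prod g (I - J)) = 0"
      using p by (simp add: degree_rat_poly)
    moreover have "J \<noteq> {}" "I - J \<noteq> {}" using cover not_cover_empty J by auto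
    ultimately show False
      using degree_prod_pos[of J] degree_prod_pos[of "I - J"] psubset_imp_subset[OF J] by simp
  qed
  moreover have "irreducible (ivp_of f)"
    if min: "\<And>J. J \<subset> I \<Longrightarrow> (\<Union>i\<in>J. root_residues p (g i)) \<noteq> {0..p - 1}"
  proof (rule irreducibleI)
    have "I \<noteq> {}" using cover_I not_cover_empty by auto
    then have deg_f: "degree f > 0"
      using degree_prod_pos[of I] p by (simp add: assms(5) degree_rat_poly)
    then show "ivp_of f \<noteq> 0"
      by (auto simp: ivp_of_eq_iff assms(6) zero_int_valued_poly.rep_eq)
    show "\<not> ivp_of f dvd 1"
      using ivp_dvd_1_imp_degree[of "ivp_of f"] deg_f by (auto simp: ivp_of_inverse assms(6))
    fix x y assume xy: "ivp_of f = x * y"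
    then have f_eq: "f = rat_poly_of x * rat_poly_of y"
      by (simp add: ivp_of_eq_iff assms(6) times_int_valued_poly.rep_eq)
    have "smult (1 / of_int p) (rat_poly (prod g I)) = rat_poly_of x * rat_poly_of y" "p \<noteq> 0"
      using p f_eq assms(5) by auto
    then obtain J c d where J: "J \<subseteq> I"
      and x: "rat_poly_of x = smult c (rat_poly (prod g J))"
      and y: "rat_poly_of y = smult d (rat_poly (prod g (I - J)))"
      and cd: "c * d = 1 / of_int p"
      using rat_poly_factor_split[where g = g, OF assms(2,3)] by blast
    \<comment> \<open>A factor with \<open>p\<close> in the denominator of its constant takes all
      the \<open>g i\<close>: this denominator divides every value of \<open>prod g K\<close>, so
      \<open>K\<close> covers all residues, and \<open>min\<close> excludes proper subsets.\<close>
    have full: "K = I" if "K \<subseteq> I" "p dvd snd (quotient_of e)"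
      "smult e (rat_poly (prod g K)) \<in> Int_Z" for K e
    proof -
      have "snd (quotient_of e) dvd poly (prod g K) n" for n
        using that(3) by (intro denominator_dvd) (simp add: Int_Z_def poly_rat_poly)
      then have "p dvd poly (prod g K) n" for n by (rule dvd_trans[OF that(2)])
      then show ?thesis using that(1) cover_iff[OF that(1)] min[of K] by blast
    qed
    have prim: "image_primitive (rat_poly_of (x * y))"
      using assms(7) f_eq by (simp add: times_int_valued_poly.rep_eq)
    \<comment> \<open>One of \<open>c\<close> and \<open>d\<close> has \<open>p\<close> in its
      denominator; its factor absorbs the whole product and leaves an empty product, hence a
      constant, to the other.\<close>
    have "J = I \<or> I - J = I"
      using rat_mult_eq_inverse_prime[OF assms(1) cd] full[of J c] full[of "I - J" d] J
        rat_poly_of[of x] rat_poly_of[of y] x y by auto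
    then show "x dvd 1 \<or> y dvd 1"
    proof
      assume "J = I"
      then have "rat_poly_of y = [:d:]" using y by simp
      then show ?thesis
        using ivp_const_factor_unit[of y d x] prim by (simp add: mult.commute)
    next
      assume "I - J = I"
      then have "J = {}" using J by auto
      then have "rat_poly_of x = [:c:]" using x by simp
      then show ?thesis using ivp_const_factor_unit prim by blast
    qed
  qed
  moreover have "minimal_p_covering p I g I"
    if min: "\<And>J. J \<subset> I \<Longrightarrow> (\<Union>i\<in>J. root_residues p (g i)) \<noteq> {0..p - 1}"
  proof -
    \<comment> \<open>An index without root residues could be dropped from \<open>I\<close> without
      losing the covering.\<close>
    have "root_residues p (g i) \<noteq> {}" if "i \<in> I" for i
    proof
      assume "root_residues p (g i) = {}"
      then have "(\<Union>j\<in>I - {i}. root_residues p (g j)) = {0..p - 1}" using cover_I by blast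
      with min[of "I - {i}"] that show False by blast
    qed
    then show ?thesis
      using min cover_I unfolding minimal_p_covering_def p_covering_def by blast
  qed
  moreover have "(\<Union>i\<in>J. root_residues p (g i)) \<noteq> {0..p - 1}"
    if "minimal_p_covering p I g I" "J \<subset> I" for J
  proof -
    \<comment> \<open>\<open>J\<close> inherits nonempty root residues from \<open>I\<close>, so it
      can only fail to be a \<open>p\<close>-covering because its union is too small.\<close>
    have "\<not> p_covering p I g J" "J \<subseteq> I" "\<forall>i\<in>J. root_residues p (g i) \<noteq> {}"
      using that by (auto simp: minimal_p_covering_def p_covering_def)
    then show ?thesis unfolding p_covering_def by simp
  qed
  ultimately show ?thesis by metis
qed

end
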